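(* Let $\mathcal{H}$ be a separable infinite-dimensional Hilbert space and let $\mathcal{F} = \{T_j\}_{j=n_0}^\infty \subseteq \mathcal{B}(\mathcal{H})$ be a forward operator monoid. Let $h, u \in \mathcal{H}$, with $u$ a normalized ($\|u\|=1$) aleph vector for $\mathcal{F}$. For each $N \ge n_0$ let $$P_N u = \sum_{j=n_0}^N c_j^{(N)} T_j h$$ be the orthogonal projection of $u$ onto $V_N := \operatorname{span}\{T_j h : j = n_0, \ldots, N\}$. Then $h$ is $\mathcal{F}$-cyclic if and only if $$c_{n_0}^{(N)} \langle h, u\rangle \to 1 \quad \text{as } N \to \infty.$$
   Context: $\mathcal{B}(\mathcal{H})$ is the set of bounded linear operators on the complex Hilbert space $\mathcal{H}$, $I$ is the identity operator, and the inner product is linear in its first argument. A collection $\mathcal{F} \subseteq \mathcal{B}(\mathcal{H})$ containing $I$ is a forward operator monoid if there is a commutative, discrete (countable), strict monoid $(\Lambda, b, n_0)$ (with binary operation $b$ and identity element $n_0$; strict means that it does not possess inverses) such that $\mathcal{F} = \{T_j\}_{j \in \Lambda}$ and the map $j \mapsto T_j$ is a monoid isomorphism from $(\Lambda, b, n_0)$ onto $(\mathcal{F}, \circ, I)$, where $\circ$ is composition. In particular: $T_{n_0} = I$; $T_jT_k = T_{b(j,k)}$ for all $j,k\in\Lambda$; the elements of $\mathcal{F}$ commute; and the forward properties hold: $T_jT_k = I$ if and only if $j=k=n_0$, and $T_jT_k = T_k$ if and only if $j = n_0$. By convention the index set is relabelled as $\Lambda = \{n_0, n_0+1, n_0+2,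 \ldots\}$, with $n_0$ still the identity element of the indexing monoid and $T_{n_0}=I$ (the operation $b$ need not be addition). A non-zero vector $h \in \mathcal{H}$ is $\mathcal{F}$-cyclic if the closed linear span $[h]_{\mathcal{F}}$ of $\{Th : T \in \mathcal{F}\}$ equals $\mathcal{H}$; it is $\mathcal{F}$-inner if $\langle Th, h\rangle = 0$ for all $T \in \mathcal{F}\setminus\{I\}$; it is an $\mathcal{F}$-aleph (aleph vector for $\mathcal{F}$) if it is both $\mathcal{F}$-cyclic and $\mathcal{F}$-inner. *)

theory Defs
  imports "HOL-Analysis.Analysis" "HOL-Algebra.Group"
begin

section \<open>Complex Hilbert spaces\<close>

text \<open>
  The underlying real structure (norm, topology, completeness) is that of the library class
  \<^class>\<open>banach\<close>; the complex scalar multiplication extends the real one, and the norm is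
  induced by the complex inner product, which is linear in its \<^emph>\<open>first\<close> argument.
\<close>

class complex_hilbert_space = banach +
  fixes scaleC :: "complex \<Rightarrow> 'a \<Rightarrow> 'a" (infixr \<open>*\<^sub>C\<close> 75)
    and cinner :: "'a \<Rightarrow> 'a \<Rightarrow> complex"
  assumes scaleC_add_right: "a *\<^sub>C (x + y) = a *\<^sub>C x + a *\<^sub>C y"
    and scaleC_add_left: "(a + b) *\<^sub>C x = a *\<^sub>C x + b *\<^sub>C x"
    and scaleC_scaleC: "a *\<^sub>C (b *\<^sub>C x) = (a * b) *\<^sub>C x"
    and scaleR_scaleC: "r *\<^sub>R x = complex_of_real r *\<^sub>C x"
    and cinner_add_left: "cinner (x + y) z = cinner x z + cinner y z"
    and cinner_scaleC_left: "cinner (a *\<^sub>C x) y = a * cinner x y"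
    and cinner_commute: "cinner x y = cnj (cinner y x)"
    and cinner_self: "cinner x x = complex_of_real ((norm x)\<^sup>2)"

lemma scaleC_one: "1 *\<^sub>C x = x"
  using scaleR_scaleC[of 1 x] by simp

global_interpretation complex_vector: vector_space "scaleC :: complex \<Rightarrow> 'a \<Rightarrow> 'a::complex_hilbert_space"
  defines cspan = complex_vector.span
  by standard (simp_all add: scaleC_add_right scaleC_add_left scaleC_scaleC scaleC_one)

definition infinite_dimensional :: "'a::complex_hilbert_space itself \<Rightarrow> bool" where
  "infinite_dimensional _ \<longleftrightarrow> \<not> (\<exists>B :: 'a set. finite B \<and> cspan B = UNIV)"

definition bounded_clinear :: "('a::complex_hilbert_space \<Rightarrow> 'a) \<Rightarrow> bool" where
  "bounded_clinear A \<longleftrightarrow> bounded_linear A \<and> (\<forall>a x. A (a *\<^sub>C x) = a *\<^sub>C A x)"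

definition orth_proj :: "'a::complex_hilbert_space set \<Rightarrow> 'a \<Rightarrow> 'a" where
  "orth_proj V x = (THE p. p \<in> V \<and> (\<forall>v\<in>V. cinner (x - p) v = 0))"

lemma cinner_add_right: "cinner x (y + z) = cinner x y + cinner x z"
  by (metis cinner_add_left cinner_commute complex_cnj_add)

lemma cinner_scaleC_right: "cinner x (a *\<^sub>C y) = cnj a * cinner x y"
  by (metis cinner_scaleC_left cinner_commute complex_cnj_mult)

lemma cinner_diff_left: "cinner (x - y) z = cinner x z - cinner y z"
  by (metis cinner_add_left add_diff_cancel diff_add_cancel)

lemma cinner_self_eq_0: "cinner x x = 0 \<longleftrightarrow> x = 0"
  by (simp add: cinner_self)

text \<open>Orthogonal projections onto finite-dimensional subspaces exist (Gram-Schmidt) and are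
  unique, so the definite description above is meaningful there.\<close>

lemma orth_proj_exists:
  assumes "finite S"
  shows "\<exists>p\<in>cspan S. \<forall>v\<in>cspan S. cinner (x - p) v = 0"
  using assms
proof (induction S arbitrary: x)
  case empty
  have "cinner x 0 = 0" for x :: 'a
    using cinner_add_right[of x 0 0] by simp
  then show ?case by simp
next
  case (insert a S)
  obtain q where q: "q \<in> cspan S" "\<forall>v\<in>cspan S. cinner (a - q) v = 0"
    using insert.IH by blast
  obtain p where p: "p \<in> cspan S" "\<forall>v\<in>cspan S. cinner (x - p) v = 0"
    using insert.IH by blast
  define e where "e = a - q"
  define k where "k = cinner (x - p) e / cinner e e"
  have sub: "v \<in> cspan (insert a S)" if "v \<in> cspan S" for v
    using that complex_vector.span_mono[of S "insert a S"] by blast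
  have "p + k *\<^sub>C e \<in> cspan (insert a S)"
    unfolding e_def
    by (intro complex_vector.span_add complex_vector.span_scale complex_vector.span_diff
        sub p q complex_vector.span_base) simp
  moreover have "cinner (x - (p + k *\<^sub>C e)) v = 0" if v: "v \<in> cspan (insert a S)" for v
  proof -
    obtain t where t: "v - t *\<^sub>C a \<in> cspan S"
      using v complex_vector.span_breakdown_eq by blast
    define w where "w = v - t *\<^sub>C a + t *\<^sub>C q"
    have w: "w \<in> cspan S"
      unfolding w_def by (intro complex_vector.span_add complex_vector.span_scale t q)
    have v_eq: "v = w + t *\<^sub>C e"
      by (simp add: w_def e_def complex_vector.scale_right_diff_distrib)
    have 1: "cinner (x - p) w = 0" "cinner e w = 0"
      using w p q by (auto simp: e_def)
    have 2: "cinner (x - p) e - k * cinner e e = 0"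
    proof (cases "e = 0")
      case True
      have "cinner (x - p) 0 = 0" using cinner_add_right[of "x - p" 0 0] by simp
      then show ?thesis using True by (simp add: k_def)
    next
      case False
      then show ?thesis by (simp add: k_def cinner_self_eq_0)
    qed
    have "cinner (x - (p + k *\<^sub>C e)) v = cinner (x - p) v - k * cinner e v"
      by (metis cinner_diff_left cinner_scaleC_left diff_diff_eq)
    also have "\<dots> = cnj t * (cinner (x - p) e - k * cinner e e)"
      by (simp add: v_eq cinner_add_right cinner_scaleC_right 1 algebra_simps)
    finally show ?thesis using 2 by simp
  qed
  ultimately show ?case by blast
qed

lemma orth_proj_unique:
  assumes "p \<in> cspan S" "\<forall>v\<in>cspan S. cinner (x - p) v = 0"
  shows "orth_proj (cspan S) x = p"
  unfolding orth_proj_def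
proof (rule the_equality)
  fix r assume r: "r \<in> cspan S \<and> (\<forall>v\<in>cspan S. cinner (x - r) v = 0)"
  have d: "r - p \<in> cspan S" using r assms complex_vector.span_diff by blast
  have "cinner (r - p) (r - p) = cinner (x - p) (r - p) - cinner (x - r) (r - p)"
    by (simp flip: cinner_diff_left)
  then show "r = p" using r assms d by (simp add: cinner_self_eq_0)
qed (use assms in blast)

section \<open>Forward operator monoids\<close>

definition operator_monoid :: "('a \<Rightarrow> 'a) set \<Rightarrow> ('a \<Rightarrow> 'a) monoid" where
  "operator_monoid F = \<lparr>carrier = F, mult = (\<circ>), one = id\<rparr>"

definition strict_monoid :: "('i, 'm) monoid_scheme \<Rightarrow> bool" where
  "strict_monoid M \<longleftrightarrow> Units M = {\<one>\<^bsub>M\<^esub>}"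

text \<open>
  The index set is \<open>{n\<^sub>0, n\<^sub>0 + 1, \<dots>}\<close>, so it is countable; the monoid operation on it is arbitrary.
  Strictness means that only the identity is invertible. It yields
  \<open>T\<^sub>j T\<^sub>k = I\<close> iff \<open>j = k = n\<^sub>0\<close>. That \<open>T\<^sub>j T\<^sub>k = T\<^sub>k\<close> forces \<open>j = n\<^sub>0\<close> is not a consequence
  (consider the maximum on the natural numbers), and is not imposed.
\<close>

definition forward_operator_monoid ::
  "('a::complex_hilbert_space \<Rightarrow> 'a) set \<Rightarrow> (int \<Rightarrow> 'a \<Rightarrow> 'a) \<Rightarrow> int \<Rightarrow> bool" where
  "forward_operator_monoid F T n\<^sub>0 \<longleftrightarrow>
     F \<subseteq> {A. bounded_clinear A} \<and> id \<in> F \<and>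
     (\<exists>M :: int monoid. carrier M = {n\<^sub>0..} \<and> \<one>\<^bsub>M\<^esub> = n\<^sub>0 \<and>
        comm_monoid M \<and> strict_monoid M \<and>
        T \<in> iso M (operator_monoid F) \<and> T n\<^sub>0 = id)"

lemma forward_operator_monoid_image: "forward_operator_monoid F T n\<^sub>0 \<Longrightarrow> F = T ` {n\<^sub>0..}"
  by (auto simp: forward_operator_monoid_def iso_def bij_betw_def operator_monoid_def)

lemma forward_operator_monoid_comp_eq_id_iff:
  assumes "forward_operator_monoid F T n\<^sub>0" "j \<ge> n\<^sub>0" "k \<ge> n\<^sub>0"
  shows "T j \<circ> T k = id \<longleftrightarrow> j = n\<^sub>0 \<and> k = n\<^sub>0"
proof -
  obtain M :: "int monoid" where M: "carrier M = {n\<^sub>0..}" "\<one>\<^bsub>M\<^esub> = n\<^sub>0" "comm_monoid M" "strict_monoid M"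
      "T \<in> iso M (operator_monoid F)" "T n\<^sub>0 = id"
    using assms(1) unfolding forward_operator_monoid_def by blast
  interpret comm_monoid M by fact
  have jk: "j \<in> carrier M" "k \<in> carrier M" using assms M by auto
  have "T (j \<otimes>\<^bsub>M\<^esub> k) = T j \<circ> T k"
    using M(5) jk by (auto simp: iso_def hom_def operator_monoid_def)
  moreover have "inj_on T (carrier M)"
    using M(5) by (simp add: iso_def bij_betw_def)
  ultimately have *: "T j \<circ> T k = id \<longleftrightarrow> j \<otimes>\<^bsub>M\<^esub> k = \<one>\<^bsub>M\<^esub>"
    using jk M(2,6) by (metis inj_onD m_closed one_closed)
  have "j \<in> Units M \<and> k \<in> Units M" if "j \<otimes>\<^bsub>M\<^esub> k = \<one>\<^bsub>M\<^esub>"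
    using that jk m_comm[OF jk] unfolding Units_def by auto
  then have "j \<otimes>\<^bsub>M\<^esub> k = \<one>\<^bsub>M\<^esub> \<Longrightarrow> j = n\<^sub>0 \<and> k = n\<^sub>0"
    using M(2,4) by (auto simp: strict_monoid_def)
  with * M(6) show ?thesis by auto
qed

section \<open>Aleph vectors\<close>

definition cyclic_vector :: "('a::complex_hilbert_space \<Rightarrow> 'a) set \<Rightarrow> 'a \<Rightarrow> bool" where
  "cyclic_vector F h \<longleftrightarrow> h \<noteq> 0 \<and> closure (cspan {A h | A. A \<in> F}) = UNIV"

definition inner_vector :: "('a::complex_hilbert_space \<Rightarrow> 'a) set \<Rightarrow> 'a \<Rightarrow> bool" where
  "inner_vector F h \<longleftrightarrow> h \<noteq> 0 \<and> (\<forall>A\<in>F - {id}. cinner (A h) h = 0)"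

definition aleph_vector :: "('a::complex_hilbert_space \<Rightarrow> 'a) set \<Rightarrow> 'a \<Rightarrow> bool" where
  "aleph_vector F h \<longleftrightarrow> cyclic_vector F h \<and> inner_vector F h"

end

theory Submission
  imports Defs
begin

text \<open>
  Write \<open>c\<^sub>j\<close> for the coefficient of \<open>T\<^sub>j h\<close> in \<open>P\<^sub>N u\<close>, suppressing \<open>N\<close>, and let \<open>c\<close> be the one with
  index \<open>n\<^sub>0\<close>, that is, the coefficient of \<open>h\<close> itself. The idea is that \<open>c \<langle>h, u\<rangle>\<close> is nothing but
  \<open>\<parallel>P\<^sub>N u\<parallel>\<^sup>2\<close>, hence it measures how well \<open>u\<close> is approximated from \<open>V\<^sub>N\<close>, the span of the \<open>T\<^sub>j h\<close>
  with \<open>j \<le> N\<close>.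

  Let \<open>j \<noteq> n\<^sub>0\<close>. Since \<open>u\<close> is inner and the index monoid is strict, \<open>T\<^sub>j T\<^sub>k u\<close> is orthogonal to
  \<open>u\<close> for every \<open>k\<close>: the product \<open>T\<^sub>j T\<^sub>k\<close> is never the identity. As \<open>u\<close> is cyclic, linear
  combinations of the \<open>T\<^sub>k u\<close> are dense, so \<open>T\<^sub>j x\<close> is orthogonal to \<open>u\<close> for \<^emph>\<open>every\<close> vector \<open>x\<close>
  (lemma \<open>aleph_orthogonal_range\<close>). In particular all terms but the first vanish in
  \<open>\<parallel>P\<^sub>N u\<parallel>\<^sup>2 = \<langle>P\<^sub>N u, u\<rangle> = \<Sum>\<^sub>j c\<^sub>j \<langle>T\<^sub>j h, u\<rangle>\<close>.

  By Pythagoras, \<open>\<parallel>u - P\<^sub>N u\<parallel>\<^sup>2 = 1 - c \<langle>h, u\<rangle>\<close>, so the limit is \<open>1\<close> if and only if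
  \<open>P\<^sub>N u\<close> tends to \<open>u\<close>. Best approximation turns this into the statement that \<open>u\<close> lies in the closed
  span \<open>[h]\<close> of the orbit of \<open>h\<close> (lemma \<open>orth_proj_tendsto_iff\<close>). Finally \<open>[h]\<close> is invariant under
  the monoid, so it contains \<open>u\<close> if and only if it contains the whole space \<open>[u]\<close>
  (lemma \<open>closed_span_orbit_eq_UNIV_iff\<close>).
\<close>

section \<open>Geometry of a complex Hilbert space\<close>

lemma cinner_zero_left [simp]: "cinner 0 x = 0"
  using cinner_add_left[of 0 0 x] by simp

lemma cinner_zero_right [simp]: "cinner x 0 = 0"
  using cinner_add_right[of x 0 0] by simp

lemma cinner_sum_left: "cinner (sum f A) x = (\<Sum>i\<in>A. cinner (f i) x)"
  by (induction A rule: infinite_finite_induct) (simp_all add: cinner_add_left)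

lemma norm_scaleC: "norm (a *\<^sub>C x) = cmod a * norm x"
proof -
  have "complex_of_real ((norm (a *\<^sub>C x))\<^sup>2) = a * cnj a * complex_of_real ((norm x)\<^sup>2)"
    unfolding cinner_self[symmetric] cinner_scaleC_left cinner_scaleC_right by (simp only: mult_ac)
  also have "\<dots> = complex_of_real ((cmod a * norm x)\<^sup>2)"
    by (simp add: power_mult_distrib flip: complex_norm_square)
  finally have "(norm (a *\<^sub>C x))\<^sup>2 = (cmod a * norm x)\<^sup>2"
    using of_real_eq_iff by blast
  then show ?thesis by simp
qed

lemma pythagoras:
  assumes "cinner x y = 0"
  shows "(norm (x + y))\<^sup>2 = (norm x)\<^sup>2 + (norm y)\<^sup>2"
proof -
  have "cinner y x = 0" using assms cinner_commute[of y x] by simp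
  then have "cinner (x + y) (x + y) = cinner x x + cinner y y"
    using assms by (simp add: cinner_add_left cinner_add_right)
  then have "complex_of_real ((norm (x + y))\<^sup>2) = complex_of_real ((norm x)\<^sup>2 + (norm y)\<^sup>2)"
    by (simp add: cinner_self)
  then show ?thesis using of_real_eq_iff by blast
qed

text \<open>Cauchy--Schwarz is Pythagoras for the decomposition of \<open>\<parallel>y\<parallel>\<^sup>2 x\<close> into its component
  \<open>\<langle>x, y\<rangle> y\<close> along \<open>y\<close> and a remainder orthogonal to \<open>y\<close>; scaling by \<open>\<parallel>y\<parallel>\<^sup>2\<close> avoids a division.\<close>

lemma cauchy_schwarz: "cmod (cinner x y) \<le> norm x * norm y"
proof (cases "y = 0")
  case False
  define r where "r = (norm y)\<^sup>2"
  define e where "e = complex_of_real r *\<^sub>C x - cinner x y *\<^sub>C y"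
  have r: "r > 0" using False by (simp add: r_def)
  have "cinner e y = 0"
    by (simp add: e_def cinner_diff_left cinner_scaleC_left cinner_self[of y] r_def)
  then have "cinner e (cinner x y *\<^sub>C y) = 0"
    by (simp add: cinner_scaleC_right)
  then have "(norm (e + cinner x y *\<^sub>C y))\<^sup>2 = (norm e)\<^sup>2 + (norm (cinner x y *\<^sub>C y))\<^sup>2"
    by (rule pythagoras)
  moreover have "e + cinner x y *\<^sub>C y = complex_of_real r *\<^sub>C x"
    by (simp add: e_def)
  ultimately have "(norm (cinner x y *\<^sub>C y))\<^sup>2 \<le> (norm (complex_of_real r *\<^sub>C x))\<^sup>2"
    by simp
  then have "cmod (cinner x y) * norm y \<le> r * norm x"
    using r by (simp add: norm_scaleC power2_le_iff_abs_le abs_mult)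
  also have "r * norm x = norm x * norm y * norm y"
    by (simp add: r_def power2_eq_square)
  finally show ?thesis using False by simp
qed simp

lemma bounded_linear_cinner_left: "bounded_linear (\<lambda>x. cinner x y)"
proof (rule bounded_linear_intro)
  show "cinner (r *\<^sub>R x) y = r *\<^sub>R cinner x y" for r x
    by (simp add: scaleR_scaleC cinner_scaleC_left scaleR_conv_of_real)
  show "norm (cinner x y) \<le> norm x * norm y" for x
    by (rule cauchy_schwarz)
qed (rule cinner_add_left)

lemma bounded_linear_scaleC: "bounded_linear (\<lambda>x. a *\<^sub>C x :: 'a::complex_hilbert_space)"
proof (rule bounded_linear_intro)
  show "a *\<^sub>C (r *\<^sub>R x) = r *\<^sub>R (a *\<^sub>C x)" for r and x :: 'a
    by (simp add: scaleR_scaleC scaleC_scaleC mult.commute)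
  show "norm (a *\<^sub>C x) \<le> norm x * cmod a" for x :: 'a
    by (simp add: norm_scaleC)
qed (rule scaleC_add_right)

section \<open>Closed spans\<close>

lemma subspace_closure:
  assumes "complex_vector.subspace (V :: 'a::complex_hilbert_space set)"
  shows "complex_vector.subspace (closure V)"
proof (rule complex_vector.subspaceI)
  show "0 \<in> closure V"
    using assms closure_subset complex_vector.subspace_0 by blast
next
  fix x y assume "x \<in> closure V" "y \<in> closure V"
  then obtain f g where "\<And>n. f n \<in> V" "f \<longlonglongrightarrow> x" "\<And>n. g n \<in> V" "g \<longlonglongrightarrow> y"
    unfolding closure_sequential by blast
  then have "\<forall>n. f n + g n \<in> V" "(\<lambda>n. f n + g n) \<longlonglongrightarrow> x + y"
    using assms by (auto intro: complex_vector.subspace_add tendsto_add)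
  then show "x + y \<in> closure V"
    unfolding closure_sequential by (intro exI[of _ "\<lambda>n. f n + g n"]) simp
next
  fix a and x assume "x \<in> closure V"
  then obtain f where "\<And>n. f n \<in> V" "f \<longlonglongrightarrow> x"
    unfolding closure_sequential by blast
  then have "\<forall>n. a *\<^sub>C f n \<in> V" "(\<lambda>n. a *\<^sub>C f n) \<longlonglongrightarrow> a *\<^sub>C x"
    using assms
    by (auto intro: complex_vector.subspace_scale bounded_linear.tendsto[OF bounded_linear_scaleC])
  then show "a *\<^sub>C x \<in> closure V"
    unfolding closure_sequential by (intro exI[of _ "\<lambda>n. a *\<^sub>C f n"]) simp
qed

lemma closure_cspan_minimal:
  assumes "S \<subseteq> W" "complex_vector.subspace W" "closed W"
  shows "closure (cspan S) \<subseteq> W"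
  using assms by (intro closure_minimal complex_vector.span_minimal)

text \<open>A continuous linear map sends a closed span into a closed subspace as soon as it does so for
  the generators. Both density arguments of the proof are instances of this.\<close>

lemma bounded_clinear_closure_cspan:
  assumes A: "bounded_clinear A"
    and W: "complex_vector.subspace W" "closed W"
    and S: "\<And>s. s \<in> S \<Longrightarrow> A s \<in> W"
    and x: "x \<in> closure (cspan S)"
  shows "A x \<in> W"
proof -
  have lin: "bounded_linear A" "\<And>a x. A (a *\<^sub>C x) = a *\<^sub>C A x"
    using A by (auto simp: bounded_clinear_def)
  interpret bounded_linear A by fact
  have "complex_vector.subspace (A -` W)"
    using W(1) by (auto intro!: complex_vector.subspaceI
        simp: zero add lin(2) complex_vector.subspace_def)
  moreover have "closed (A -` W)"
    using W(2) by (intro closed_vimage continuous_on continuous_on_id)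
  ultimately have "closure (cspan S) \<subseteq> A -` W"
    using S by (intro closure_cspan_minimal) auto
  then show ?thesis using x by blast
qed

text \<open>A linear combination involves only finitely many members of a chain, so the span of the
  union of an increasing family is the union of the spans.\<close>

lemma cspan_UN_mono:
  fixes S :: "'i::linorder \<Rightarrow> 'a::complex_hilbert_space set"
  assumes "\<And>M N. m \<le> M \<Longrightarrow> M \<le> N \<Longrightarrow> S M \<subseteq> S N"
  shows "cspan (\<Union>N\<in>{m..}. S N) = (\<Union>N\<in>{m..}. cspan (S N))"
proof
  have mono: "x \<in> cspan (S N)" if "m \<le> M" "M \<le> N" "x \<in> cspan (S M)" for x M N
    using that assms[of M N] complex_vector.span_mono by blast
  have "complex_vector.subspace (\<Union>N\<in>{m..}. cspan (S N))"
  proof (rule complex_vector.subspaceI)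
    show "0 \<in> (\<Union>N\<in>{m..}. cspan (S N))"
      using complex_vector.span_zero by blast
  next
    fix x y assume "x \<in> (\<Union>N\<in>{m..}. cspan (S N))" "y \<in> (\<Union>N\<in>{m..}. cspan (S N))"
    then obtain M N where "M \<ge> m" "x \<in> cspan (S M)" "N \<ge> m" "y \<in> cspan (S N)"
      by auto
    then have "x + y \<in> cspan (S (max M N))"
      by (intro complex_vector.span_add) (auto intro: mono[of M] mono[of N])
    then show "x + y \<in> (\<Union>N\<in>{m..}. cspan (S N))"
      using \<open>M \<ge> m\<close> by (auto intro!: bexI[of _ "max M N"] simp: le_max_iff_disj)
  qed (auto intro: complex_vector.span_scale)
  then show "cspan (\<Union>N\<in>{m..}. S N) \<subseteq> (\<Union>N\<in>{m..}. cspan (S N))"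
    by (intro complex_vector.span_minimal) (auto intro: complex_vector.span_base)
  show "(\<Union>N\<in>{m..}. cspan (S N)) \<subseteq> cspan (\<Union>N\<in>{m..}. S N)"
    by (intro UN_least complex_vector.span_mono) auto
qed

section \<open>Orthogonal projections onto an increasing sequence of subspaces\<close>

lemma
  assumes "finite S"
  shows orth_proj_in: "orth_proj (cspan S) x \<in> cspan S"
    and orth_proj_orthogonal: "v \<in> cspan S \<Longrightarrow> cinner (x - orth_proj (cspan S) x) v = 0"
  using orth_proj_exists[OF assms, of x] orth_proj_unique[of _ S x] by auto

lemma cinner_orth_proj_self:
  assumes "finite S"
  shows "cinner (orth_proj (cspan S) x) x = complex_of_real ((norm (orth_proj (cspan S) x))\<^sup>2)"
proof -
  let ?p = "orth_proj (cspan S) x"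
  have "cinner (x - ?p) ?p = 0"
    using assms by (intro orth_proj_orthogonal orth_proj_in)
  then have "cinner x ?p = complex_of_real ((norm ?p)\<^sup>2)"
    by (simp add: cinner_diff_left cinner_self)
  then show ?thesis using cinner_commute[of ?p x] by simp
qed

lemma norm_orth_proj_residual:
  assumes "finite S"
  shows "(norm (x - orth_proj (cspan S) x))\<^sup>2 = (norm x)\<^sup>2 - (norm (orth_proj (cspan S) x))\<^sup>2"
  using pythagoras[of "x - orth_proj (cspan S) x" "orth_proj (cspan S) x"]
  by (simp add: assms orth_proj_orthogonal orth_proj_in)

lemma orth_proj_best_approximation:
  assumes "finite S" "v \<in> cspan S"
  shows "norm (x - orth_proj (cspan S) x) \<le> norm (x - v)"
proof -
  let ?p = "orth_proj (cspan S) x"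
  have "cinner (x - ?p) (?p - v) = 0"
    using assms by (intro orth_proj_orthogonal complex_vector.span_diff orth_proj_in)
  from pythagoras[OF this] have "(norm (x - ?p))\<^sup>2 \<le> (norm (x - v))\<^sup>2"
    by simp
  then show ?thesis by simp
qed

lemma orth_proj_tendsto_iff:
  fixes S :: "'i::linorder \<Rightarrow> 'a::complex_hilbert_space set"
  assumes fin: "\<And>N. finite (S N)"
    and mono: "\<And>M N. m \<le> M \<Longrightarrow> M \<le> N \<Longrightarrow> S M \<subseteq> S N"
  shows "((\<lambda>N. norm (x - orth_proj (cspan (S N)) x)) \<longlongrightarrow> 0) at_top
    \<longleftrightarrow> x \<in> closure (cspan (\<Union>N\<in>{m..}. S N))"
    (is "(?d \<longlongrightarrow> 0) at_top \<longleftrightarrow> _")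
proof
  assume lim: "(?d \<longlongrightarrow> 0) at_top"
  show "x \<in> closure (cspan (\<Union>N\<in>{m..}. S N))"
    unfolding closure_approachable
  proof (intro allI impI)
    fix e :: real assume "e > 0"
    then have "eventually (\<lambda>N. ?d N < e) at_top"
      using lim by (intro order_tendstoD)
    then obtain M where M: "?d N < e" if "N \<ge> M" for N
      unfolding eventually_at_top_linorder by blast
    define N where "N = max m M"
    have N: "N \<ge> m" "?d N < e"
      unfolding N_def by (auto intro: M)
    then have "orth_proj (cspan (S N)) x \<in> cspan (\<Union>N\<in>{m..}. S N)"
      using orth_proj_in[OF fin] by (subst cspan_UN_mono[of m S, OF mono]) auto
    moreover have "dist (orth_proj (cspan (S N)) x) x < e"
      using N by (simp add: dist_norm norm_minus_commute)
    ultimately show "\<exists>y\<in>cspan (\<Union>N\<in>{m..}. S N). dist y x < e" by blast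
  qed
next
  assume x: "x \<in> closure (cspan (\<Union>N\<in>{m..}. S N))"
  show "(?d \<longlongrightarrow> 0) at_top"
  proof (rule tendstoI)
    fix e :: real assume "e > 0"
    then obtain v where v: "v \<in> cspan (\<Union>N\<in>{m..}. S N)" "norm (x - v) < e"
      using x unfolding closure_approachable by (auto simp: dist_norm norm_minus_commute)
    then obtain M where M: "M \<ge> m" "v \<in> cspan (S M)"
      using cspan_UN_mono[of m S, OF mono] by auto
    have "dist (?d N) 0 < e" if "N \<ge> M" for N
    proof -
      have "v \<in> cspan (S N)"
        using complex_vector.span_mono[OF mono[OF M(1) that]] M(2) by blast
      from orth_proj_best_approximation[OF fin this, of x] show ?thesis
        using v(2) by simp
    qed
    then show "eventually (\<lambda>N. dist (?d N) 0 < e) at_top"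
      by (auto simp: eventually_at_top_linorder)
  qed
qed

section \<open>Orbits of a forward operator monoid\<close>

abbreviation orbit :: "('a \<Rightarrow> 'a) set \<Rightarrow> 'a \<Rightarrow> 'a set" where
  "orbit F x \<equiv> {A x | A. A \<in> F}"

lemma forward_operator_monoid_bounded_clinear:
  "forward_operator_monoid F T n\<^sub>0 \<Longrightarrow> A \<in> F \<Longrightarrow> bounded_clinear A"
  by (auto simp: forward_operator_monoid_def)

lemma forward_operator_monoid_comp:
  assumes "forward_operator_monoid F T n\<^sub>0" "A \<in> F" "B \<in> F"
  shows "A \<circ> B \<in> F"
proof -
  obtain M :: "int monoid" where M: "comm_monoid M" "T \<in> iso M (operator_monoid F)"
    using assms(1) unfolding forward_operator_monoid_def by blast
  interpret comm_monoid M by fact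
  have T: "T ` carrier M = F" "\<And>j k. j \<in> carrier M \<Longrightarrow> k \<in> carrier M \<Longrightarrow> T (j \<otimes>\<^bsub>M\<^esub> k) = T j \<circ> T k"
    using M(2) by (auto simp: iso_def hom_def bij_betw_def operator_monoid_def)
  obtain j k where "j \<in> carrier M" "k \<in> carrier M" "A = T j" "B = T k"
    using assms T(1) by blast
  then show ?thesis using T m_closed by (metis imageI)
qed

text \<open>The inner property controls the operator \<open>T\<^sub>j\<close> only on the orbit of \<open>u\<close>; strictness makes
  \<open>T\<^sub>j T\<^sub>k\<close> different from the identity, so \<open>T\<^sub>j\<close> maps this orbit, and by cyclicity everything,
  into the orthogonal complement of \<open>u\<close>.\<close>

lemma aleph_orthogonal_range:
  assumes F: "forward_operator_monoid F T n\<^sub>0"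
    and u: "aleph_vector F u"
    and j: "j > n\<^sub>0"
  shows "cinner (T j x) u = 0"
proof -
  have F_eq: "F = T ` {n\<^sub>0..}" by (rule forward_operator_monoid_image[OF F])
  have Tj: "T j \<in> F" using j F_eq by auto
  let ?W = "{y. cinner y u = 0}"
  have W: "complex_vector.subspace ?W"
    by (auto intro!: complex_vector.subspaceI simp: cinner_add_left cinner_scaleC_left)
  have "T j s \<in> ?W" if "s \<in> orbit F u" for s
  proof -
    obtain k where k: "k \<ge> n\<^sub>0" "s = T k u" using \<open>s \<in> orbit F u\<close> F_eq by auto
    have "T j \<circ> T k \<in> F"
      using k Tj F_eq by (intro forward_operator_monoid_comp[OF F]) auto
    moreover have "T j \<circ> T k \<noteq> id"
      using forward_operator_monoid_comp_eq_id_iff[OF F, of j k] j k by auto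
    ultimately have "cinner ((T j \<circ> T k) u) u = 0"
      using u unfolding aleph_vector_def inner_vector_def by blast
    then show ?thesis by (simp add: k)
  qed
  moreover have "closed ?W"
    by (intro closed_Collect_eq continuous_on_const
        bounded_linear.continuous_on[OF bounded_linear_cinner_left] continuous_on_id)
  moreover have "x \<in> closure (cspan (orbit F u))"
    using u by (simp add: aleph_vector_def cyclic_vector_def)
  ultimately have "T j x \<in> ?W"
    using bounded_clinear_closure_cspan[OF forward_operator_monoid_bounded_clinear[OF F Tj] W]
    by blast
  then show ?thesis by simp
qed

text \<open>The closed span of an orbit is invariant under the monoid, so it contains the orbit of each
  of its vectors, in particular that of a cyclic one.\<close>

lemma closed_span_orbit_eq_UNIV_iff:
  assumes F: "forward_operator_monoid F T n\<^sub>0"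
    and u: "cyclic_vector F u"
  shows "closure (cspan (orbit F h)) = UNIV \<longleftrightarrow> u \<in> closure (cspan (orbit F h))"
proof
  let ?W = "closure (cspan (orbit F h))"
  have W: "complex_vector.subspace ?W"
    by (intro subspace_closure complex_vector.subspace_span)
  assume uW: "u \<in> ?W"
  have "A u \<in> ?W" if A: "A \<in> F" for A
  proof (rule bounded_clinear_closure_cspan[OF _ W closed_closure _ uW])
    show "bounded_clinear A" by (rule forward_operator_monoid_bounded_clinear[OF F A])
    fix s assume "s \<in> orbit F h"
    then obtain B where B: "B \<in> F" "s = B h" by blast
    have "A \<circ> B \<in> F"
      by (rule forward_operator_monoid_comp[OF F A B(1)])
    moreover have "A s = (A \<circ> B) h"
      using B(2) by simp
    ultimately have "A s \<in> orbit F h"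
      by (intro CollectI exI[of _ "A \<circ> B"] conjI)
    then show "A s \<in> ?W"
      by (rule subsetD[OF closure_subset complex_vector.span_base])
  qed
  then have "closure (cspan (orbit F u)) \<subseteq> ?W"
    using W by (intro closure_cspan_minimal) auto
  then show "?W = UNIV"
    using u by (auto simp: cyclic_vector_def)
qed simp

section \<open>The cyclicity criterion\<close>

theorem theorem4p5:
  fixes F :: "('a::complex_hilbert_space \<Rightarrow> 'a) set"
    and T :: "int \<Rightarrow> 'a \<Rightarrow> 'a"
    and n\<^sub>0 :: int
    and h u :: 'a
    and c :: "int \<Rightarrow> int \<Rightarrow> complex"
  assumes "separable_space (euclidean :: 'a topology)"
    and "infinite_dimensional TYPE('a)"
    and "forward_operator_monoid F T n\<^sub>0"
    and "aleph_vector F u"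
    and "norm u = 1"
    and "\<And>N. N \<ge> n\<^sub>0 \<Longrightarrow>
           orth_proj (cspan {T j h | j. j \<in> {n\<^sub>0..N}}) u = (\<Sum>j=n\<^sub>0..N. c N j *\<^sub>C T j h)"
  shows "cyclic_vector F h \<longleftrightarrow> ((\<lambda>N. c N n\<^sub>0 * cinner h u) \<longlongrightarrow> 1) at_top"
proof -
  note F = assms(3) and u = assms(4)
  define S where "S N = {T j h | j. j \<in> {n\<^sub>0..N}}" for N
  define d where "d N = norm (u - orth_proj (cspan (S N)) u)" for N
  have fin: "finite (S N)" for N
    unfolding S_def by simp
  have mono: "S M \<subseteq> S N" if "M \<le> N" for M N
    using that by (auto simp: S_def)
  have orbit_eq: "orbit F h = (\<Union>N\<in>{n\<^sub>0..}. S N)"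
    unfolding S_def using forward_operator_monoid_image[OF F] by fastforce
  have "T n\<^sub>0 = id"
    using F by (auto simp: forward_operator_monoid_def)
  have coeff: "c N n\<^sub>0 * cinner h u = complex_of_real (1 - (d N)\<^sup>2)" if N: "N \<ge> n\<^sub>0" for N
  proof -
    have "complex_of_real (1 - (d N)\<^sup>2) = cinner (orth_proj (cspan (S N)) u) u"
      using norm_orth_proj_residual[OF fin, of u N] assms(5)
      by (simp add: d_def cinner_orth_proj_self[OF fin])
    also have "\<dots> = (\<Sum>j=n\<^sub>0..N. c N j * cinner (T j h) u)"
      using assms(6)[OF N] by (simp add: S_def cinner_sum_left cinner_scaleC_left)
    also have "\<dots> = (\<Sum>j=n\<^sub>0..N. if j = n\<^sub>0 then c N n\<^sub>0 * cinner h u else 0)"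
      using aleph_orthogonal_range[OF F u, of _ h] \<open>T n\<^sub>0 = id\<close> by (intro sum.cong) auto
    also have "\<dots> = c N n\<^sub>0 * cinner h u"
      using N by simp
    finally show ?thesis by simp
  qed
  have "((\<lambda>N. c N n\<^sub>0 * cinner h u) \<longlongrightarrow> 1) at_top
      \<longleftrightarrow> ((\<lambda>N. complex_of_real (1 - (d N)\<^sup>2)) \<longlongrightarrow> complex_of_real 1) at_top"
    unfolding of_real_1
    by (intro tendsto_cong eventually_mono[OF eventually_ge_at_top[of n\<^sub>0]] coeff)
  also have "\<dots> \<longleftrightarrow> ((\<lambda>N. 1 - (d N)\<^sup>2) \<longlongrightarrow> 1) at_top"
    by (rule tendsto_of_real_iff)
  also have "\<dots> \<longleftrightarrow> (d \<longlongrightarrow> 0) at_top"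
  proof
    assume "((\<lambda>N. 1 - (d N)\<^sup>2) \<longlongrightarrow> 1) at_top"
    from tendsto_real_sqrt[OF tendsto_diff[OF tendsto_const[of 1] this]]
    have "((\<lambda>N. sqrt ((d N)\<^sup>2)) \<longlongrightarrow> 0) at_top" by simp
    moreover have "sqrt ((d N)\<^sup>2) = d N" for N by (simp add: d_def)
    ultimately show "(d \<longlongrightarrow> 0) at_top" by simp
  next
    assume "(d \<longlongrightarrow> 0) at_top"
    from tendsto_diff[OF tendsto_const[of 1] tendsto_power[OF this, of 2]]
    show "((\<lambda>N. 1 - (d N)\<^sup>2) \<longlongrightarrow> 1) at_top" by simp
  qed
  also have "\<dots> \<longleftrightarrow> u \<in> closure (cspan (orbit F h))"
    unfolding d_def orbit_eq by (rule orth_proj_tendsto_iff[OF fin mono])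
  also have "\<dots> \<longleftrightarrow> closure (cspan (orbit F h)) = UNIV"
    using u closed_span_orbit_eq_UNIV_iff[OF F, of u h] by (simp add: aleph_vector_def)
  finally have lim_iff: "((\<lambda>N. c N n\<^sub>0 * cinner h u) \<longlongrightarrow> 1) at_top
      \<longleftrightarrow> closure (cspan (orbit F h)) = UNIV" .
  \<comment> \<open>Cyclicity also demands \<open>h \<noteq> 0\<close>; for \<open>h = 0\<close> the sequence is constantly \<open>0\<close>.\<close>
  have "h \<noteq> 0" if "((\<lambda>N. c N n\<^sub>0 * cinner h u) \<longlongrightarrow> 1) at_top"
    using that by (auto simp: tendsto_const_iff)
  with lim_iff show ?thesis
    by (auto simp: cyclic_vector_def)
qed

end
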